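(* Let $\alpha>1$ be a real algebraic number and let $P(x)=a_dx^d+\dots+a_0\in\mathbb{R}[x]$ be a polynomial such that $P(1)\neq 0$ and $P(\alpha')=0$ for every Galois conjugate $\alpha'\neq\alpha$ of $\alpha$. Let $\beta\in\mathbb{R}$. Let $(n_k)_{k\geqslant 1}$ be a strictly increasing sequence of positive integers. Assume that the sequence $(\sigma_k)_{k\geqslant 1}:=(n_{k+1}-\alpha n_k-\beta\ln n_k)_{k\geqslant 1}$ is bounded and that there exists an $(a_0,\dots,a_d)$-thin subset $I\subseteq\mathbb{R}$ such that $$\delta:=\inf_J\ \overline{\mathsf{ud}}\bigl(A(\sigma_\bullet,J)\bigr)>1-\frac{1}{d+1},$$ where $J$ runs through the open neighborhoods of $I$ in $\mathbb{R}$. Then $\theta:=\frac{\beta\ln\alpha}{\alpha-1}\in\mathbb{Q}$.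
   Context: For a finite collection of real numbers $(a_0,\dots,a_d)$, a bounded subset $I\subseteq\mathbb{R}$ is called $(a_0,\dots,a_d)$-thin if the closure of the Minkowski sum $\sum_{s=0}^d a_sI=\{\sum_{s=0}^d a_sx_s\mid x_0,\dots,x_d\in I\}$ in $\mathbb{R}$ has Lebesgue measure zero. For a sequence $(x_k)_{k\geqslant 1}$ and a set $J$, $A(x_\bullet,J):=\{k\geqslant 1\mid x_k\in J\}$. For $A\subseteq\mathbb{Z}_{\geqslant 1}$, its upper uniform density is $$\overline{\mathsf{ud}}(A):=\lim_{n\to\infty}\frac1n\sup_{h\in\mathbb{Z}_{\geqslant 0}}\#\bigl(A\cap[h+1,h+n]\bigr)$$ (the limit is known to exist). *)

theory Defs
  imports "HOL-Analysis.Analysis" "HOL-Computational_Algebra.Computational_Algebra"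
begin

definition is_min_poly :: "rat poly \<Rightarrow> complex \<Rightarrow> bool" where
  "is_min_poly p x \<longleftrightarrow>
     lead_coeff p = 1 \<and> irreducible p \<and> poly (map_poly of_rat p) x = 0"

(* The Galois conjugates of an algebraic x are the complex roots of its minimal polynomial
   over the rationals; x is one of them. *)
definition galois_conjugate :: "complex \<Rightarrow> complex \<Rightarrow> bool" where
  "galois_conjugate z x \<longleftrightarrow> (\<exists>p. is_min_poly p x \<and> poly (map_poly of_rat p) z = 0)"

definition minkowski_comb :: "(nat \<Rightarrow> real) \<Rightarrow> nat \<Rightarrow> real set \<Rightarrow> real set" where
  "minkowski_comb a d I = {\<Sum>s\<le>d. a s * x s | x. \<forall>s\<le>d. x s \<in> I}"

definition thin :: "(nat \<Rightarrow> real) \<Rightarrow> nat \<Rightarrow> real set \<Rightarrow> bool" where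
  "thin a d I \<longleftrightarrow> bounded I \<and> closure (minkowski_comb a d I) \<in> null_sets lebesgue"

(* Sequences are indexed from 1; the value at 0 is never used. *)
definition hit_set :: "(nat \<Rightarrow> real) \<Rightarrow> real set \<Rightarrow> nat set" where
  "hit_set x J = {k. k \<ge> 1 \<and> x k \<in> J}"

(* The counts lie between 0 and n and are subadditive in n, so the real supremum is the true one
   and the limit exists by Fekete's lemma. *)
definition upper_uniform_density :: "nat set \<Rightarrow> real" where
  "upper_uniform_density A =
     lim (\<lambda>n. (SUP h. real (card (A \<inter> {h + 1..h + n}))) / real n)"

end

theory Submission
  imports Defs "HOL-Computational_Algebra.Field_as_Ring" "HOL-Real_Asymp.Real_Asymp"
begin

text \<open>
  The minimal polynomial of \<open>\<alpha>\<close> has simple roots, so some integer multiple of it is \<open>(x - \<alpha>) R\<close>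
  with \<open>P = R S\<close>. Let \<open>\<tau>\<close> be the shift of sequences. The numbers \<open>m\<^sub>k = (\<tau> - \<alpha>) R(\<tau>) n\<^sub>k\<close> are integers, and
  since \<open>ln n\<^sub>k = k ln \<alpha> + const + o(1)\<close>, one gets \<open>R(\<tau>) \<sigma>\<^sub>k = m\<^sub>k - \<phi> k + const + o(1)\<close> where \<open>\<phi>\<close> is a
  nonzero integer multiple of \<open>\<theta>\<close>. As \<open>\<sigma>\<close> is bounded, \<open>m\<^sub>k - \<lfloor>\<phi> k\<rfloor>\<close> takes finitely many values, and applying
  \<open>S(\<tau>)\<close> shows that \<open>P(\<tau>) \<sigma>\<^sub>k + S(1) {\<phi> k}\<close> is within \<open>o(1)\<close> of a fixed finite set.

  If all of \<open>\<sigma>\<^sub>k, \<dots>, \<sigma>\<^sub>k\<^sub>+\<^sub>d\<close> lie near \<open>I\<close>, then \<open>P(\<tau>) \<sigma>\<^sub>k\<close> lies near the compact null set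
  \<open>closure (\<Sum>s. a\<^sub>s I)\<close>, hence \<open>{\<phi> k}\<close> lies near a fixed compact null set. Since \<open>\<delta> > 1 - 1 / (d + 1)\<close>,
  these \<open>k\<close> have positive density in arbitrarily long windows, whereas for irrational \<open>\<phi>\<close> the
  density of such \<open>k\<close> is arbitrarily small, uniformly over all long windows.
\<close>

subsection \<open>Minimal polynomials over the rationals\<close>

lemma map_poly_mult_hom:
  fixes f :: "'a::comm_semiring_0 \<Rightarrow> 'b::comm_semiring_0"
  assumes "f 0 = 0" "\<And>x y. f (x + y) = f x + f y" "\<And>x y. f (x * y) = f x * f y"
  shows "map_poly f (p * q) = map_poly f p * map_poly f q"
proof (rule poly_eqI)
  fix i
  have "f (sum g A) = (\<Sum>x\<in>A. f (g x))" for g :: "nat \<Rightarrow> 'a" and A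
    by (induction A rule: infinite_finite_induct) (simp_all add: assms)
  then show "coeff (map_poly f (p * q)) i = coeff (map_poly f p * map_poly f q) i"
    by (simp add: coeff_map_poly assms(1,3) coeff_mult)
qed

lemma map_poly_add_hom:
  assumes "f 0 = 0" "\<And>x y. f (x + y) = f x + f y"
  shows "map_poly f (p + q) = map_poly f p + map_poly f q"
  by (rule poly_eqI) (simp add: coeff_map_poly assms)

lemma pderiv_map_of_rat:
  "pderiv (map_poly of_rat p) = (map_poly of_rat (pderiv p) :: 'a::field_char_0 poly)"
  by (rule poly_eqI) (simp add: coeff_map_poly coeff_pderiv of_rat_mult of_rat_add)

lemma map_poly_of_real_of_rat:
  "map_poly complex_of_real (map_poly of_rat p) = map_poly of_rat p"
proof (rule poly_eqI)
  have "complex_of_real (of_rat r) = of_rat r" for r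
    by (cases r) (simp add: of_rat_rat)
  then show "coeff (map_poly complex_of_real (map_poly of_rat p)) i = coeff (map_poly of_rat p) i" for i
    by (simp add: coeff_map_poly)
qed

text \<open>A nonzero rational polynomial of least degree vanishing at \<open>x\<close>, made monic,
  is irreducible: in any factorisation one factor vanishes at \<open>x\<close>, hence has full
  degree, and the other is a constant.\<close>

lemma min_poly_exists:
  fixes x :: complex
  assumes "algebraic x"
  shows "\<exists>p. is_min_poly p x"
proof -
  define root :: "rat poly \<Rightarrow> bool" where "root p \<longleftrightarrow> poly (map_poly of_rat p) x = 0" for p
  obtain q' where q': "\<And>i. coeff q' i \<in> \<rat>" "q' \<noteq> 0" "poly q' x = 0"
    using assms by (auto simp: algebraic_altdef)
  obtain q where "q' = map_poly of_rat q"
    using ratpolyE q'(1) by blast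
  then have "q \<noteq> 0 \<and> root q"
    using q' by (auto simp: root_def)
  then obtain p0 where p0: "p0 \<noteq> 0" "root p0"
      and least: "\<And>r. r \<noteq> 0 \<Longrightarrow> root r \<Longrightarrow> degree p0 \<le> degree r"
    using ex_has_least_nat[of "\<lambda>r. r \<noteq> 0 \<and> root r" q degree] by auto
  define p where "p = smult (inverse (lead_coeff p0)) p0"
  have p: "p \<noteq> 0" "lead_coeff p = 1" "degree p = degree p0"
    using p0 by (simp_all add: p_def)
  have root_mult: "root (r * s) \<longleftrightarrow> root r \<or> root s" for r s
    by (simp add: root_def map_poly_mult_hom of_rat_add of_rat_mult)
  have "p = [:inverse (lead_coeff p0):] * p0"
    by (simp add: p_def)
  then have "root p"
    using p0 root_mult by metis
  have "irreducible p"
  proof (rule irreducibleI)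
    show "p \<noteq> 0" by fact
    show "\<not> is_unit p"
    proof
      assume "is_unit p"
      then obtain c where "p = [:c:]" "c \<noteq> 0"
        using \<open>p \<noteq> 0\<close> by (auto simp: is_unit_poly_iff)
      with \<open>root p\<close> show False
        by (simp add: root_def map_poly_pCons)
    qed
    fix r s assume rs: "p = r * s"
    have *: "is_unit t" if "u \<noteq> 0" "root u" "p = u * t" for u t
      using that least[of u] p by (simp add: is_unit_iff_degree degree_mult_eq)
    have "r \<noteq> 0" "s \<noteq> 0"
      using rs p by auto
    moreover have "root r \<or> root s"
      using \<open>root p\<close> rs root_mult by metis
    ultimately show "is_unit r \<or> is_unit s"
      using *[of r s] *[of s r] rs by (auto simp: mult.commute)
  qed
  with p(2) \<open>root p\<close> show ?thesis
    unfolding is_min_poly_def root_def by blast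
qed

text \<open>In characteristic zero the derivative of \<open>p\<close> is nonzero and of smaller
  degree, hence coprime to \<open>p\<close>; the Bezout identity evaluated at a double root would
  read \<open>0 = 1\<close>.\<close>

lemma irreducible_rat_poly_simple_roots:
  fixes z :: complex
  assumes "irreducible p" and "poly (map_poly of_rat p) z = 0"
  shows "poly (pderiv (map_poly of_rat p)) z \<noteq> 0"
proof
  assume z': "poly (pderiv (map_poly of_rat p)) z = 0"
  have "p \<noteq> 0" using assms(1) by auto
  have "degree p \<noteq> 0"
    using assms(1) \<open>p \<noteq> 0\<close> by (auto simp: irreducible_def is_unit_iff_degree)
  then have "pderiv p \<noteq> 0" "degree (pderiv p) < degree p"
    by (simp_all add: pderiv_eq_0_iff degree_pderiv)
  then have "\<not> p dvd pderiv p"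
    using dvd_imp_degree_le leD by blast
  then have "coprime p (pderiv p)"
    using irreducibleD'[OF assms(1)] by (meson coprimeI dvd_trans)
  then obtain u v where "u * p + v * pderiv p = 1"
    using bezout_coefficients_fst_snd[of p "pderiv p"] that by (simp add: coprime_iff_gcd_eq_1)
  then have "map_poly of_rat (u * p + v * pderiv p) = (1 :: complex poly)"
    by simp
  then have "map_poly of_rat u * map_poly of_rat p + map_poly of_rat v * map_poly of_rat (pderiv p)
      = (1 :: complex poly)"
    by (simp add: map_poly_add_hom map_poly_mult_hom of_rat_add of_rat_mult)
  then have "poly (map_poly of_rat u * map_poly of_rat p
      + map_poly of_rat v * map_poly of_rat (pderiv p)) z = 1"
    by simp
  then show False
    using assms(2) z' by (simp add: pderiv_map_of_rat)
qed

text \<open>Division takes place over the reals, so the quotient is real; only roots are counted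
  over the complex numbers. A nonzero remainder would have smaller degree than \<open>R\<close> yet
  vanish at its \<open>degree R\<close> distinct roots.\<close>

lemma rsquarefree_dvd_if_roots:
  fixes R P :: "real poly"
  assumes "rsquarefree (map_poly complex_of_real R)"
    and "\<And>z. poly (map_poly complex_of_real R) z = 0 \<Longrightarrow> poly (map_poly complex_of_real P) z = 0"
  shows "R dvd P"
proof (rule ccontr)
  let ?c = "map_poly complex_of_real"
  assume "\<not> R dvd P"
  define T where "T = P mod R"
  have "T \<noteq> 0"
    using \<open>\<not> R dvd P\<close> by (simp add: T_def dvd_eq_mod_eq_0)
  have "R \<noteq> 0"
    using assms(1) by (auto simp: rsquarefree_def)
  then have "degree T < degree R"
    using \<open>T \<noteq> 0\<close> degree_mod_less T_def by blast
  have "?c P = ?c (P div R * R + T)"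
    by (simp add: T_def)
  also have "\<dots> = ?c (P div R) * ?c R + ?c T"
    by (simp add: map_poly_add_hom map_poly_mult_hom)
  finally have T: "poly (?c T) z = 0" if "poly (?c R) z = 0" for z
    using assms(2)[OF that] that by simp
  have cT: "?c T \<noteq> 0"
    using \<open>T \<noteq> 0\<close> by (simp add: map_poly_eq_0_iff)
  have "degree R = degree (?c R)"
    by (simp add: degree_map_poly)
  also have "\<dots> = card {z. poly (?c R) z = 0}"
  proof -
    have "?c R = smult (lead_coeff (?c R)) (\<Prod>z | poly (?c R) z = 0. [:-z, 1:])"
      using complex_poly_decompose_rsquarefree[OF assms(1)] by simp
    then have "degree (?c R) = degree (\<Prod>z | poly (?c R) z = 0. [:-z, 1:])"
      using assms(1) by (metis degree_smult_eq leading_coeff_0_iff rsquarefree_def)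
    then show ?thesis
      by (simp add: degree_prod_eq_sum_degree)
  qed
  also have "\<dots> \<le> card {z. poly (?c T) z = 0}"
    using T cT by (intro card_mono poly_roots_finite) auto
  also have "\<dots> \<le> degree (?c T)"
    using cT by (intro card_poly_roots_bound) auto
  also have "\<dots> = degree T"
    by (simp add: degree_map_poly)
  finally show False
    using \<open>degree T < degree R\<close> by simp
qed

lemma common_denominator:
  fixes p :: "rat poly"
  shows "\<exists>D>0. \<forall>i. of_int D * coeff p i \<in> \<int>"
proof -
  define D where "D = (\<Prod>j\<le>degree p. snd (quotient_of (coeff p j)))"
  have "of_int D * coeff p i \<in> \<int>" for i
  proof (cases "i \<le> degree p")
    case True
    have "coeff p i = of_int (fst (quotient_of (coeff p i))) / of_int (snd (quotient_of (coeff p i)))"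
      by (metis prod.collapse quotient_of_div)
    moreover have "snd (quotient_of (coeff p i)) \<noteq> 0"
      using quotient_of_denom_pos'[of "coeff p i"] by simp
    moreover have "snd (quotient_of (coeff p i)) dvd D"
      unfolding D_def using True by (intro dvd_prodI) auto
    ultimately show ?thesis
      by (smt (verit) Ints_of_int dvd_def mult.commute mult.left_commute nonzero_mult_div_cancel_left of_int_eq_0_iff of_int_mult times_divide_eq_right)
  qed (simp add: coeff_eq_0)
  moreover have "D > 0"
    unfolding D_def by (intro prod_pos) (simp add: quotient_of_denom_pos')
  ultimately show ?thesis by blast
qed

text \<open>\<open>R\<close> is the minimal polynomial of \<alpha> divided by its factor at \<alpha>
  and scaled to clear denominators. Its roots are simple and are the conjugates other than \<alpha>,
  so it divides \<open>P\<close>.\<close>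

lemma conjugate_factor:
  fixes \<alpha> :: real and P :: "real poly"
  assumes "algebraic \<alpha>"
    and "\<And>z. galois_conjugate z (complex_of_real \<alpha>) \<Longrightarrow> z \<noteq> complex_of_real \<alpha> \<Longrightarrow>
           poly (map_poly complex_of_real P) z = 0"
  obtains R S where "P = R * S" "\<And>i. coeff ([:-\<alpha>, 1:] * R) i \<in> \<int>"
proof -
  let ?c = "map_poly complex_of_real"
  have "algebraic (complex_of_real \<alpha>)"
    using assms(1) by (simp add: algebraic_of_real_iff)
  then obtain p where p: "is_min_poly p (complex_of_real \<alpha>)"
    using min_poly_exists by blast
  have irr: "irreducible p" using p by (simp add: is_min_poly_def)
  have of_real_poly: "poly (?c q) (complex_of_real x) = complex_of_real (poly q x)" for q x
    by (induction q) (simp_all add: map_poly_pCons)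
  have "poly (map_poly of_rat p) \<alpha> = 0"
    using p of_real_poly[of "map_poly of_rat p" \<alpha>]
    by (simp add: is_min_poly_def map_poly_of_real_of_rat)
  then obtain R where R: "map_poly of_rat p = [:-\<alpha>, 1:] * R"
    by (metis poly_eq_0_iff_dvd dvd_def)
  have "map_poly of_rat p = ?c ([:-\<alpha>, 1:] * R)"
    using R map_poly_of_real_of_rat by metis
  then have cp: "map_poly of_rat p = [:-complex_of_real \<alpha>, 1:] * ?c R"
    by (simp add: map_poly_mult_hom map_poly_pCons del: mult_pCons_left)
  \<comment> \<open>At a root \<open>z\<close> of \<open>?c R\<close> the derivative of the product
    is \<open>z - \<alpha>\<close> times the derivative of \<open>?c R\<close>, so either
    alternative would make \<open>z\<close> a multiple root of the irreducible
    \<open>p\<close>.\<close>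
  have simple: "\<not> (poly (?c R) z = 0 \<and> (z = complex_of_real \<alpha> \<or> poly (pderiv (?c R)) z = 0))" for z
    using irreducible_rat_poly_simple_roots[OF irr, of z]
    by (auto simp: cp pderiv_mult pderiv_pCons simp del: mult_pCons_left)
  have "rsquarefree (?c R)"
    using simple by (auto simp: rsquarefree_roots)
  moreover have "poly (?c P) z = 0" if "poly (?c R) z = 0" for z
  proof (rule assms(2))
    show "z \<noteq> complex_of_real \<alpha>"
      using simple that by blast
    show "galois_conjugate z (complex_of_real \<alpha>)"
      using p that unfolding galois_conjugate_def by (intro exI[of _ p]) (simp add: cp)
  qed
  ultimately obtain S where S: "P = R * S"
    using rsquarefree_dvd_if_roots by (metis dvd_def)
  obtain D where D: "D > 0" "\<And>i. of_int D * coeff p i \<in> \<int>"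
    using common_denominator by blast
  show thesis
  proof
    show "P = smult (of_int D) R * smult (1 / of_int D) S"
      using D S by simp
    fix i
    have "[:-\<alpha>, 1:] * smult (of_int D) R = smult (of_int D) (map_poly of_rat p)"
      by (simp only: R mult_smult_right)
    then have "coeff ([:-\<alpha>, 1:] * smult (of_int D) R) i = of_rat (of_int D * coeff p i)"
      by (simp add: coeff_map_poly of_rat_mult del: mult_pCons_left)
    also have "\<dots> \<in> \<int>"
      using D(2)[of i] by (auto elim!: Ints_cases)
    finally show "coeff ([:-\<alpha>, 1:] * smult (of_int D) R) i \<in> \<int>" .
  qed
qed

subsection \<open>Irrational rotations near a null set\<close>

text \<open>No nonzero integer multiple of \<phi> is an integer, so each has positive distance to
  the integers, and finitely many such distances have a positive minimum.\<close>

lemma irrational_dist_Ints_pos: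
  fixes \<phi> :: real
  assumes "\<phi> \<notin> \<rat>" and "finite M" and "0 \<notin> M"
  shows "\<exists>g>0. \<forall>m\<in>M. \<forall>j::int. g \<le> \<bar>of_int m * \<phi> - of_int j\<bar>"
  using assms(2,3)
proof (induction M)
  case empty
  then show ?case by (auto intro: exI[of _ 1])
next
  case (insert m M)
  then obtain g where g: "g > 0" "\<And>i j. i \<in> M \<Longrightarrow> g \<le> \<bar>of_int i * \<phi> - of_int j\<bar>"
    by auto
  define x where "x = of_int m * \<phi>"
  have "x \<notin> \<int>"
  proof
    assume "x \<in> \<int>"
    then have "x / of_int m \<in> \<rat>"
      using Ints_subset_Rats by (intro Rats_divide) auto
    with assms(1) insert.prems show False
      by (simp add: x_def)
  qed
  then have *: "0 < x - of_int \<lfloor>x\<rfloor>" "0 < of_int \<lfloor>x\<rfloor> + 1 - x"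
    using floor_correct[of x] by (force simp: Ints_def less_le)+
  have m: "min (x - of_int \<lfloor>x\<rfloor>) (of_int \<lfloor>x\<rfloor> + 1 - x) \<le> \<bar>x - of_int j\<bar>" for j
  proof (cases "j \<le> \<lfloor>x\<rfloor>")
    case True
    then have "real_of_int j \<le> of_int \<lfloor>x\<rfloor>" by simp
    then show ?thesis by linarith
  next
    case False
    then have "real_of_int \<lfloor>x\<rfloor> + 1 \<le> of_int j" by linarith
    then show ?thesis by linarith
  qed
  show ?case
  proof (intro exI conjI ballI allI)
    show "0 < min g (min (x - of_int \<lfloor>x\<rfloor>) (of_int \<lfloor>x\<rfloor> + 1 - x))"
      using g * by simp
  next
    fix i j assume "i \<in> insert m M"
    then show "min g (min (x - of_int \<lfloor>x\<rfloor>) (of_int \<lfloor>x\<rfloor> + 1 - x)) \<le> \<bar>of_int i * \<phi> - of_int j\<bar>"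
    proof
      assume "i = m" then show ?thesis using m[of j] by (simp add: x_def min_def)
    next
      assume "i \<in> M" then show ?thesis using g(2)[of i j] by simp
    qed
  qed
qed

text \<open>The witnesses are the denominators of the rational approximations of Dirichlet.\<close>

lemma irrational_separated:
  fixes \<phi> :: real
  assumes "\<phi> \<notin> \<rat>"
  shows "\<exists>q::nat>Q. \<forall>m j::int. m \<noteq> 0 \<longrightarrow> 2 * \<bar>m\<bar> \<le> int q \<longrightarrow> 1 / (2 * real q) \<le> \<bar>of_int m * \<phi> - of_int j\<bar>"
proof -
  obtain g where g: "g > 0" "\<And>m j. m \<in> {1..int Q} \<Longrightarrow> g \<le> \<bar>of_int m * \<phi> - of_int j\<bar>"
    using irrational_dist_Ints_pos[OF assms, of "{1..int Q}"] by auto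
  obtain N :: nat where N: "N > 0" "1 / real N < g"
    using real_arch_invD[OF g(1)] by (metis gr0I inverse_eq_divide)
  obtain h k where hk: "coprime h k" "0 < k" "k \<le> int N" "\<bar>of_int k * \<phi> - of_int h\<bar> < 1 / N"
    using Dirichlet_approx_coprime[OF \<open>N > 0\<close>] by blast
  \<comment> \<open>Otherwise \<open>k\<close> would be one of the multipliers controlled by
    \<open>g\<close>, although \<open>|k * \<phi> - h| < 1 / N < g\<close>.\<close>
  have "\<not> k \<le> int Q"
    using g(2)[of k h] hk N by auto
  moreover have "1 / (2 * of_int k) \<le> \<bar>of_int m * \<phi> - of_int j\<bar>"
    if m: "m \<noteq> 0" "2 * \<bar>m\<bar> \<le> k" for m j
  proof -
    \<comment> \<open>The integer \<open>m * h - j * k\<close> equals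
      \<open>k * (m * \<phi> - j) - m * (k * \<phi> - h)\<close>, whose second term is at most
      \<open>1 / 2\<close> in size. Once it is known to be nonzero,
      \<open>k * |m * \<phi> - j|\<close> is at least \<open>1 / 2\<close>.\<close>
    have "m * h - j * k \<noteq> 0"
    proof
      assume "m * h - j * k = 0"
      then have "k dvd m * h" by simp
      then have "k dvd m"
        using hk(1) by (simp add: coprime_commute coprime_dvd_mult_left_iff)
      then show False
        using m hk(2) zdvd_imp_le[of k "\<bar>m\<bar>"] by auto
    qed
    then have "1 \<le> \<bar>m * h - j * k\<bar>" by linarith
    then have "1 \<le> \<bar>real_of_int (m * h - j * k)\<bar>"
      by (metis of_int_1_le_iff of_int_abs)
    also have "\<dots> = \<bar>of_int k * (of_int m * \<phi> - of_int j) - of_int m * (of_int k * \<phi> - of_int h)\<bar>"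
      by (simp add: algebra_simps)
    also have "\<dots> \<le> of_int k * \<bar>of_int m * \<phi> - of_int j\<bar> + \<bar>of_int m\<bar> * \<bar>of_int k * \<phi> - of_int h\<bar>"
      using abs_triangle_ineq4 hk(2) by (metis abs_mult abs_of_pos of_int_0_less_iff)
    also have "\<bar>of_int m\<bar> * \<bar>of_int k * \<phi> - of_int h\<bar> \<le> (of_int k / 2) * (1 / of_int k)"
    proof (rule mult_mono)
      have "real_of_int (2 * \<bar>m\<bar>) \<le> of_int k"
        using m by (simp only: of_int_le_iff)
      then show "\<bar>real_of_int m\<bar> \<le> of_int k / 2" by simp
      have "of_int k \<le> real N"
        using hk(3) by (metis of_int_le_iff of_int_of_nat_eq)
      then have "1 / real N \<le> 1 / of_int k"
        using hk(2) by (intro divide_left_mono) auto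
      then show "\<bar>of_int k * \<phi> - of_int h\<bar> \<le> 1 / of_int k"
        using hk(4) by linarith
    qed (use hk in auto)
    finally show ?thesis
      using hk(2) by (simp add: field_simps)
  qed
  ultimately show ?thesis
    using hk(2) by (intro exI[of _ "nat k"]) auto
qed

lemma card_grid_cells_le_measure:
  fixes V :: "real set" and J :: "int set"
  assumes "V \<in> lmeasurable" and "M > 0" and "finite J"
    and "\<And>j. j \<in> J \<Longrightarrow> {of_int j / M ..< (of_int j + 1) / M} \<subseteq> V"
  shows "real (card J) \<le> M * measure lebesgue V"
proof -
  let ?C = "\<lambda>j::int. {of_int j / M ..< (of_int j + 1) / M}"
  have "\<lfloor>x * M\<rfloor> = j" if "x \<in> ?C j" for x j
    using that assms(2) by (intro floor_unique) (auto simp: field_simps)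
  then have disj: "disjoint_family_on ?C J"
    unfolding disjoint_family_on_def by blast
  have C: "measure lebesgue (?C j) = 1 / M" for j
    using assms(2) by (simp add: divide_right_mono) (simp add: diff_divide_distrib[symmetric])
  have "real (card J) / M = (\<Sum>j\<in>J. measure lebesgue (?C j))"
    by (simp add: C)
  also have "\<dots> = measure lebesgue (\<Union>j\<in>J. ?C j)"
    using disj assms(2) by (intro measure_finite_Union[symmetric] assms(3)) (simp_all add: divide_right_mono image_subset_iff)
  also have "\<dots> \<le> measure lebesgue V"
    using assms by (intro measure_mono_fmeasurable) auto
  finally show ?thesis
    using assms(2) by (simp add: field_simps)
qed

text \<open>Indices in a window of length \<open>Suc (q div 2)\<close> differ by at most
  \<open>q / 2\<close>, the range in which \<open>sep\<close> applies. Hence the counted points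
  occupy distinct cells of length \<open>1 / (2 * q)\<close>, and \<open>near\<close> places these
  cells inside \<open>V\<close>.\<close>

lemma irrational_rotation_block_count:
  fixes \<phi> :: real and V K :: "real set"
  assumes sep: "\<And>m j::int. m \<noteq> 0 \<Longrightarrow> 2 * \<bar>m\<bar> \<le> int q \<Longrightarrow> 1 / (2 * real q) \<le> \<bar>of_int m * \<phi> - of_int j\<bar>"
    and "q > 0" and V: "V \<in> lmeasurable"
    and near: "\<And>x y. y \<in> K \<Longrightarrow> \<bar>x - y\<bar> < r + 1 / (2 * real q) \<Longrightarrow> x \<in> V"
  shows "real (card {k\<in>{h+1..h + Suc (q div 2)}. \<exists>y\<in>K. \<bar>frac (\<phi> * real k) - y\<bar> < r})
     \<le> 2 * real q * measure lebesgue V"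
proof -
  let ?B = "{k\<in>{h+1..h + Suc (q div 2)}. \<exists>y\<in>K. \<bar>frac (\<phi> * real k) - y\<bar> < r}"
  define c where "c k = \<lfloor>frac (\<phi> * real k) * (2 * real q)\<rfloor>" for k :: nat
  define M where "M = 2 * real q"
  have M: "M > 0" using assms(2) by (simp add: M_def)
  have c: "of_int (c k) / M \<le> frac (\<phi> * real k)" "frac (\<phi> * real k) < (of_int (c k) + 1) / M" for k
    using floor_correct[of "frac (\<phi> * real k) * M"] M by (auto simp: c_def M_def field_simps)
  \<comment> \<open>Two points in the same cell of the grid of mesh \<open>1 / M\<close> would be too close to each other.\<close>
  have "inj_on c ?B"
  proof (rule inj_onI, rule ccontr)
    fix k l assume k: "k \<in> ?B" and l: "l \<in> ?B" and eq: "c k = c l" and "k \<noteq> l"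
    define m where "m = int k - int l"
    define j where "j = \<lfloor>\<phi> * real k\<rfloor> - \<lfloor>\<phi> * real l\<rfloor>"
    have "of_int m * \<phi> - of_int j = frac (\<phi> * real k) - frac (\<phi> * real l)"
      by (simp add: m_def j_def frac_def algebra_simps)
    moreover have "\<bar>frac (\<phi> * real k) - frac (\<phi> * real l)\<bar> < 1 / M"
      using c[of k] c[of l] eq by (simp add: add_divide_distrib)
    moreover have "m \<noteq> 0" using \<open>k \<noteq> l\<close> by (simp add: m_def)
    ultimately have "m \<noteq> 0" "\<bar>of_int m * \<phi> - of_int j\<bar> < 1 / M" by simp_all
    have "k \<le> l + q div 2" "l \<le> k + q div 2" using k l by auto
    then have "\<bar>m\<bar> \<le> int (q div 2)" by (simp add: m_def)
    moreover have "2 * int (q div 2) \<le> int q" by simp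
    ultimately have "2 * \<bar>m\<bar> \<le> int q" by linarith
    with sep[of m j] \<open>m \<noteq> 0\<close> \<open>\<bar>of_int m * \<phi> - of_int j\<bar> < 1 / M\<close> show False by (simp add: M_def)
  qed
  then have "card ?B = card (c ` ?B)"
    by (simp add: card_image)
  moreover have "real (card (c ` ?B)) \<le> M * measure lebesgue V"
  proof (rule card_grid_cells_le_measure[OF V M])
    fix j assume "j \<in> c ` ?B"
    then obtain k y where k: "c k = j" "y \<in> K" "\<bar>frac (\<phi> * real k) - y\<bar> < r"
      by blast
    show "{of_int j / M ..< (of_int j + 1) / M} \<subseteq> V"
    proof
      fix x assume "x \<in> {of_int j / M ..< (of_int j + 1) / M}"
      then have "\<bar>x - frac (\<phi> * real k)\<bar> < 1 / M"
        using c[of k] k(1) by (simp add: add_divide_distrib) linarith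
      then show "x \<in> V"
        using k by (intro near[OF k(2)]) (simp add: M_def)
    qed
  qed simp
  ultimately show ?thesis by (simp add: M_def)
qed

lemma card_le_by_blocks:
  assumes block: "\<And>h. card (B \<inter> {h+1..h+L}) \<le> b"
  shows "card (B \<inter> {h+1..h + t * L}) \<le> t * b"
proof (induction t)
  case (Suc t)
  have "B \<inter> {h+1..h + Suc t * L} = B \<inter> {h+1..h + t * L} \<union> B \<inter> {(h + t * L)+1..(h + t * L) + L}"
    by auto
  then have "card (B \<inter> {h+1..h + Suc t * L}) \<le> t * b + b"
    using card_Un_le add_mono[OF Suc block[of "h + t * L"]] by (metis le_trans)
  then show ?case by simp
qed simp

text \<open>By compactness a whole neighbourhood of \<open>K\<close> lies in an open set of small
  measure. For a suitable \<open>q\<close> the block count bounds the hits in every block of length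
  about \<open>q / 2\<close>, wherever it starts, which makes the estimate uniform in
  \<open>h\<close>.\<close>

lemma irrational_rotation_near_null_set:
  fixes \<phi> :: real and K :: "real set"
  assumes "\<phi> \<notin> \<rat>" and "compact K" and "K \<in> null_sets lebesgue" and "\<epsilon> > 0"
  shows "\<exists>r>0. \<exists>N. \<forall>n\<ge>N. \<forall>h.
     real (card {k\<in>{h+1..h+n}. \<exists>y\<in>K. \<bar>frac (\<phi> * real k) - y\<bar> < r}) \<le> \<epsilon> * real n"
proof -
  \<comment> \<open>Of the factor 8, \<open>2 * q \<le> 4 * L\<close> takes 4 and rounding
    \<open>n\<close> up to a multiple of the block length \<open>L\<close> takes 2.\<close>
  obtain U where U: "open U" "K \<subseteq> U" "U - K \<in> lmeasurable" "emeasure lebesgue (U - K) < ennreal (\<epsilon> / 8)"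
    using sets_lebesgue_outer_open[of K "\<epsilon> / 8"] assms(3,4) by auto
  have Um: "U \<in> lmeasurable"
    using U(2,3) assms(3) fmeasurable.Un[of "U - K" lebesgue K]
    by (simp add: Un_absorb2 fmeasurableI_null_sets)
  have "measure lebesgue U = measure lebesgue (U - K)"
    using U Um assms(3) by (simp add: measure_Diff_null_set fmeasurableD)
  also have "\<dots> < \<epsilon> / 8"
    using U(3,4) assms(4) by (simp add: emeasure_eq_measure2 ennreal_less_iff)
  finally have mU: "measure lebesgue U < \<epsilon> / 8" .
  obtain e where e: "e > 0" "(\<Union>x\<in>K. ball x e) \<subseteq> U"
    using compact_subset_open_imp_ball_epsilon_subset[OF assms(2) U(1,2)] by blast
  obtain Q :: nat where Q: "1 / e < real Q"
    using reals_Archimedean2 by blast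
  obtain q :: nat where q: "q > Q"
    and sep: "\<And>m j::int. m \<noteq> 0 \<Longrightarrow> 2 * \<bar>m\<bar> \<le> int q \<Longrightarrow> 1 / (2 * real q) \<le> \<bar>of_int m * \<phi> - of_int j\<bar>"
    using irrational_separated[OF assms(1)] by blast
  have "1 / e < real q" using q Q by linarith
  then have "1 / real q < e"
    using e(1) q by (simp add: field_simps)
  then have q2: "1 / (2 * real q) < e / 2" by simp
  \<comment> \<open>The other half of \<open>e\<close> pays for the grid mesh
    \<open>1 / (2 * q)\<close>.\<close>
  define r where "r = e / 2"
  define B where "B = {k. \<exists>y\<in>K. \<bar>frac (\<phi> * real k) - y\<bar> < r}"
  have B: "B \<inter> A = {k\<in>A. \<exists>y\<in>K. \<bar>frac (\<phi> * real k) - y\<bar> < r}" for A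
    by (auto simp: B_def)
  define L where "L = Suc (q div 2)"
  define b where "b = nat \<lfloor>2 * real q * measure lebesgue U\<rfloor>"
  have near: "x \<in> U" if "y \<in> K" "\<bar>x - y\<bar> < r + 1 / (2 * real q)" for x y
  proof -
    have "\<bar>y - x\<bar> < e" using that(2) q2 unfolding r_def by linarith
    then have "x \<in> ball y e" by (simp add: dist_real_def)
    then show ?thesis using e(2) that(1) by blast
  qed
  have "real (card (B \<inter> {h+1..h+L})) \<le> 2 * real q * measure lebesgue U" for h
    unfolding B L_def using q
    by (intro irrational_rotation_block_count[OF sep _ Um near]) auto
  then have "card (B \<inter> {h+1..h+L}) \<le> b" for h
    unfolding b_def by (simp add: le_nat_floor)
  note blocks = card_le_by_blocks[of B L b, OF this]
  have "real b \<le> 2 * real q * measure lebesgue U"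
    by (simp add: b_def)
  also have "\<dots> \<le> 2 * real q * (\<epsilon> / 8)"
    using mU by (intro mult_left_mono) auto
  also have "\<dots> \<le> \<epsilon> / 2 * real L"
  proof -
    have "real q \<le> 2 * real L" by (simp add: L_def)
    then show ?thesis using assms(4) by (simp add: mult.commute)
  qed
  finally have bL: "real b \<le> \<epsilon> / 2 * real L" .
  show ?thesis
  proof (intro exI conjI allI impI)
    show "r > 0" using e by (simp add: r_def)
    fix n h assume n: "n \<ge> L"
    \<comment> \<open>This many blocks cover the window, and \<open>n \<ge> L\<close> keeps their
      total length within \<open>2 * n\<close>.\<close>
    define t where "t = Suc (n div L)"
    have "L > 0" by (simp add: L_def)
    then have t: "n \<le> t * L" "t * L \<le> 2 * n"
      using n div_mult_mod_eq[of n L] mod_less_divisor[of L n] unfolding t_def mult_Suc by linarith+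
    have "card (B \<inter> {h+1..h+n}) \<le> card (B \<inter> {h+1..h+t*L})"
      using t by (intro card_mono) auto
    also have "\<dots> \<le> t * b" by (rule blocks)
    finally have "real (card (B \<inter> {h+1..h+n})) \<le> real t * real b"
      by (metis of_nat_le_iff of_nat_mult)
    also have "\<dots> \<le> real t * (\<epsilon> / 2 * real L)"
      using bL by (intro mult_left_mono) auto
    also have "\<dots> = \<epsilon> / 2 * real (t * L)" by simp
    also have "\<dots> \<le> \<epsilon> / 2 * real (2 * n)"
      using t(2) assms(4) by (intro mult_left_mono of_nat_mono) auto
    finally show "real (card {k\<in>{h+1..h+n}. \<exists>y\<in>K. \<bar>frac (\<phi> * real k) - y\<bar> < r}) \<le> \<epsilon> * real n"
      by (simp add: B)
  qed
qed

subsection \<open>Upper uniform density\<close>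

text \<open>Fekete's lemma. If \<open>f m / m\<close> is close to the infimum, splitting
  \<open>n\<close> into \<open>n div m\<close> pieces of length \<open>m\<close> and a remainder
  bounds \<open>f n / n\<close>; the remainder contributes at most \<open>C / n\<close>, where
  \<open>C\<close> bounds \<open>f\<close> on \<open>{..<m}\<close>.\<close>

lemma subadditive_ratio_tendsto_INF:
  fixes f :: "nat \<Rightarrow> real"
  assumes sub: "\<And>m n. f (m + n) \<le> f m + f n" and nonneg: "\<And>n. 0 \<le> f n"
  shows "(\<lambda>n. f n / real n) \<longlonglongrightarrow> (INF n\<in>{1..}. f n / real n)"
proof -
  let ?l = "INF n\<in>{1..}. f n / real n"
  have bdd: "bdd_below ((\<lambda>n. f n / real n) ` {1..})"
    using nonneg by (intro bdd_belowI[of _ 0]) auto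
  have mult: "f (t * m + s) \<le> real t * f m + f s" for t m s
  proof (induction t)
    case (Suc t)
    have "f (Suc t * m + s) = f (m + (t * m + s))" by (simp add: algebra_simps)
    also have "\<dots> \<le> f m + f (t * m + s)" by (rule sub)
    finally show ?case using Suc by (simp add: algebra_simps)
  qed simp
  show ?thesis
  proof (rule LIMSEQ_I)
    fix e :: real assume "e > 0"
    then obtain m where m: "m \<ge> 1" "f m / real m < ?l + e / 2"
      using cINF_less_iff[OF _ bdd, of "?l + e / 2"] by auto
    define C where "C = Max (f ` {..<m})"
    have C: "f s \<le> C" if "s < m" for s
      unfolding C_def using that by (intro Max_ge) auto
    obtain N :: nat where N: "2 * C / e < real N" using reals_Archimedean2 by blast
    have "norm (f n / real n - ?l) < e" if n: "n \<ge> Suc N" for n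
    proof -
      have "f n \<le> real (n div m) * f m + f (n mod m)"
        using mult[of "n div m" m "n mod m"] by simp
      also have "\<dots> \<le> (real n / real m) * f m + C"
        using m nonneg[of m] by (intro add_mono mult_right_mono C of_nat_div_le_of_nat) simp_all
      finally have "f n / real n \<le> ((real n / real m) * f m + C) / real n"
        by (rule divide_right_mono) simp
      also have "\<dots> = f m / real m + C / real n"
        using n by (simp add: add_divide_distrib)
      finally have "f n / real n \<le> f m / real m + C / real n" .
      moreover have "C / real n < e / 2"
      proof -
        have "2 * C / e < real n" using N n by linarith
        then show ?thesis using \<open>e > 0\<close> n by (simp add: field_simps)
      qed
      moreover have "?l \<le> f n / real n"
        using n by (intro cINF_lower[OF bdd]) auto
      ultimately show ?thesis using m(2) unfolding real_norm_def by linarith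
    qed
    then show "\<exists>no. \<forall>n\<ge>no. norm (f n / real n - ?l) < e" by blast
  qed
qed

lemma window_count_bdd:
  "bdd_above (range (\<lambda>h::nat. real (card (A \<inter> {h + 1..h + n}))))"
proof (rule bdd_aboveI2)
  fix h :: nat
  have "card (A \<inter> {h + 1..h + n}) \<le> card {h + 1..h + n}"
    by (rule card_mono) auto
  then show "real (card (A \<inter> {h + 1..h + n})) \<le> real n" by simp
qed

lemma window_count_SUP_nonneg:
  "0 \<le> (SUP h::nat. real (card (A \<inter> {h + 1..h + n})))"
  using cSUP_upper[OF _ window_count_bdd, of 0 A n] by (meson UNIV_I of_nat_0_le_iff order_trans)

text \<open>Cutting a window into two adjacent ones makes the supremum subadditive in the length.
  The infimum form is the useful one: it gives information at every single window length.\<close>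

lemma upper_uniform_density_eq_INF:
  "upper_uniform_density A =
     (INF n\<in>{1..}. (SUP h. real (card (A \<inter> {h + 1..h + n}))) / real n)"
  unfolding upper_uniform_density_def
proof (rule limI, rule subadditive_ratio_tendsto_INF)
  fix m n :: nat
  let ?f = "\<lambda>n. SUP h. real (card (A \<inter> {h + 1..h + n}))"
  show "?f (m + n) \<le> ?f m + ?f n"
  proof (rule cSUP_least)
    fix h :: nat
    have "A \<inter> {h + 1..h + (m + n)} = A \<inter> {h + 1..h + m} \<union> A \<inter> {(h + m) + 1..(h + m) + n}"
      by auto
    then have "card (A \<inter> {h + 1..h + (m + n)})
        \<le> card (A \<inter> {h + 1..h + m}) + card (A \<inter> {(h + m) + 1..(h + m) + n})"
      using card_Un_le by metis
    also have "real \<dots> \<le> ?f m + ?f n"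
      unfolding of_nat_add by (intro add_mono cSUP_upper window_count_bdd) auto
    finally show "real (card (A \<inter> {h + 1..h + (m + n)})) \<le> ?f m + ?f n" by simp
  qed simp
  show "0 \<le> ?f n" by (rule window_count_SUP_nonneg)
qed

lemma upper_uniform_density_nonneg: "0 \<le> upper_uniform_density A"
  unfolding upper_uniform_density_eq_INF
by (intro cINF_greatest divide_nonneg_nonneg window_count_SUP_nonneg) auto

lemma upper_uniform_density_window:
  assumes "c < upper_uniform_density A" and "n \<ge> 1"
  shows "\<exists>h. c * real n < real (card (A \<inter> {h + 1..h + n}))"
proof -
  let ?g = "\<lambda>n. (SUP h. real (card (A \<inter> {h + 1..h + n}))) / real n"
  have "0 \<le> ?g m" for m
    by (intro divide_nonneg_nonneg window_count_SUP_nonneg) simp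
  then have "bdd_below (?g ` {1..})"
    by (intro bdd_belowI[of _ 0]) auto
  then have "upper_uniform_density A \<le> ?g n"
    unfolding upper_uniform_density_eq_INF using assms(2) by (intro cINF_lower) auto
  then have "c * real n < (SUP h. real (card (A \<inter> {h + 1..h + n})))"
    using assms(2) less_le_trans[OF assms(1)] by (simp add: pos_less_divide_eq[symmetric])
  then show ?thesis
    using less_cSUP_iff[OF _ window_count_bdd] by blast
qed

text \<open>A union bound over the \<open>d + 1\<close> shifts. For fixed \<open>s\<close>, shifting
  the \<open>k\<close> with \<open>k + s \<notin> A\<close> puts them into the part of the window
  outside \<open>A\<close>, except for at most \<open>s\<close> that pass its right end.\<close>

lemma simultaneous_window_count:
  fixes A :: "nat set" and \<delta> :: real
  assumes "\<delta> * real n \<le> real (card (A \<inter> {h+1..h+n}))"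
  shows "(1 - (real d + 1) * (1 - \<delta>)) * real n - (real d + 1) * real d
     \<le> real (card {k\<in>{h+1..h+n}. \<forall>s\<le>d. k + s \<in> A})"
proof -
  let ?W = "{h+1..h+n}"
  let ?bad = "\<lambda>s. {k\<in>?W. k + s \<notin> A}"
  have bad: "real (card (?bad s)) \<le> (1 - \<delta>) * real n + real d" if "s \<le> d" for s
  proof -
    have "card (?bad s) = card ((\<lambda>k. k + s) ` ?bad s)"
      by (simp add: card_image)
    also have "\<dots> \<le> card ((?W - A) \<union> {h+n+1..h+n+s})"
      by (intro card_mono) auto
    also have "\<dots> \<le> card (?W - A) + s"
      using card_Un_le[of "?W - A" "{h+n+1..h+n+s}"] by simp
    also have "card (?W - A) = n - card (A \<inter> ?W)"
      by (simp add: card_Diff_subset_Int Int_commute)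
    finally have "real (card (?bad s)) \<le> real (n - card (A \<inter> ?W)) + real s"
      by (simp flip: of_nat_add)
    moreover have "card (A \<inter> ?W) \<le> n"
      using card_mono[of ?W "A \<inter> ?W"] by simp
    ultimately show ?thesis
      using assms that by (simp add: of_nat_diff algebra_simps)
  qed
  let ?good = "{k\<in>?W. \<forall>s\<le>d. k + s \<in> A}"
  have "card ?W = card (?good \<union> (\<Union>s\<le>d. ?bad s))"
    by (rule arg_cong[where f = card]) auto
  then have "n \<le> card ?good + card (\<Union>s\<le>d. ?bad s)"
    using card_Un_le[of ?good "\<Union>s\<le>d. ?bad s"] card_atLeastAtMost[of "h + 1" "h + n"] by linarith
  moreover have "card (\<Union>s\<le>d. ?bad s) \<le> (\<Sum>s\<le>d. card (?bad s))"
    by (rule card_UN_le) simp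
  ultimately have "real n \<le> real (card ?good) + (\<Sum>s\<le>d. real (card (?bad s)))"
    unfolding of_nat_sum[symmetric] of_nat_add[symmetric] of_nat_le_iff by linarith
  also have "(\<Sum>s\<le>d. real (card (?bad s))) \<le> (\<Sum>s\<le>d. (1 - \<delta>) * real n + real d)"
    using bad by (intro sum_mono) auto
  finally show ?thesis by (simp add: algebra_simps)
qed

subsection \<open>Logarithmic asymptotics\<close>

lemma ln_le_two_sqrt:
  fixes x :: real
  assumes "x > 0"
  shows "ln x \<le> 2 * sqrt x"
proof -
  have "ln (sqrt x) \<le> sqrt x"
    using assms ln_le_minus_one[of "sqrt x"] by simp
  then show ?thesis using assms by (simp add: ln_sqrt)
qed

lemma abs_ln_one_plus_le:
  fixes x :: real
  assumes "\<bar>x\<bar> \<le> 1/2"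
  shows "\<bar>ln (1 + x)\<bar> \<le> 2 * \<bar>x\<bar>"
proof -
  have "\<bar>ln (1 + x) - x\<bar> \<le> 2 * x\<^sup>2"
    using abs_ln_one_plus_x_minus_x_bound[OF assms] .
  also have "2 * x\<^sup>2 = 2 * \<bar>x\<bar> * \<bar>x\<bar>"
    by (simp add: power2_eq_square)
  also have "\<dots> \<le> 1 * \<bar>x\<bar>"
    using assms by (intro mult_right_mono) auto
  finally show ?thesis by linarith
qed

text \<open>
  The increments of \<open>ln (n k) - k * ln \<alpha>\<close> are \<open>O (1 / sqrt (n k))\<close>, and \<open>n\<close> grows at least
  geometrically.
\<close>

lemma ln_minus_linear_convergent:
  fixes n :: "nat \<Rightarrow> nat" and \<sigma> :: "nat \<Rightarrow> real"
  assumes "\<alpha> > 1" and pos: "\<And>k. k \<ge> 1 \<Longrightarrow> n k > 0"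
    and mono: "strict_mono_on {1..} n"
    and rec: "\<And>k. k \<ge> 1 \<Longrightarrow> \<sigma> k = real (n (k + 1)) - \<alpha> * real (n k) - \<beta> * ln (real (n k))"
    and B: "\<And>k. k \<ge> 1 \<Longrightarrow> \<bar>\<sigma> k\<bar> \<le> B"
  shows "convergent (\<lambda>k. ln (real (n k)) - real k * ln \<alpha>)"
proof -
  define f where "f k = 1 / sqrt (real (n k))" for k
  \<comment> \<open>The relative error in \<open>n (k + 1) = \<alpha> * n k * (1 + D k)\<close>;
    bounding the logarithm by a square root makes it \<open>O(f k)\<close>.\<close>
  define D where "D k = (\<beta> * ln (real (n k)) + \<sigma> k) / (\<alpha> * real (n k))" for k
  define C where "C = 2 * \<bar>\<beta>\<bar> + B"
  have "B \<ge> 0" using B[of 1] by simp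
  then have "C \<ge> 0" by (simp add: C_def)
  have nk: "real k \<le> real (n k)" if "k \<ge> 1" for k
    using that
  proof (induction k rule: dec_induct)
    case base
    then show ?case using pos[of 1] by simp
  next
    case (step k)
    then have "n k < n (Suc k)" using strict_mono_onD[OF mono, of k "Suc k"] by simp
    then show ?case using step by simp
  qed
  have step: "real (n (k + 1)) = \<alpha> * real (n k) * (1 + D k)" if "k \<ge> 1" for k
    using rec[OF that] pos[OF that] assms(1) by (simp add: D_def field_simps)
  have Df: "\<bar>D k\<bar> \<le> C * f k" if k: "k \<ge> 1" for k
  proof -
    let ?x = "real (n k)"
    have x: "?x \<ge> 1" using pos[OF k] by simp
    have "\<bar>\<beta> * ln ?x + \<sigma> k\<bar> \<le> \<bar>\<beta>\<bar> * ln ?x + B"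
      using B[OF k] x abs_triangle_ineq[of "\<beta> * ln ?x" "\<sigma> k"] by (simp add: abs_mult)
    also have "\<dots> \<le> \<bar>\<beta>\<bar> * (2 * sqrt ?x) + B * sqrt ?x"
      using x ln_le_two_sqrt[of ?x] \<open>B \<ge> 0\<close> mult_left_mono[of 1 "sqrt ?x" B]
      by (intro add_mono mult_left_mono) auto
    also have "\<dots> = C * sqrt ?x" by (simp add: C_def algebra_simps)
    finally have "\<bar>D k\<bar> \<le> C * sqrt ?x / (\<alpha> * ?x)"
      using x assms(1) by (simp add: D_def abs_mult divide_right_mono)
    also have "\<dots> \<le> C * sqrt ?x / ?x"
      using x assms(1) \<open>C \<ge> 0\<close> by (intro divide_left_mono) auto
    also have "\<dots> = C * f k"
      using x by (simp add: f_def real_div_sqrt field_simps)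
    finally show ?thesis .
  qed
  have "(\<lambda>k. 1 / sqrt (real k)) \<longlonglongrightarrow> 0"
    by real_asymp
  then have f0: "f \<longlonglongrightarrow> 0"
  proof (rule Lim_null_comparison[rotated])
    show "\<forall>\<^sub>F k in sequentially. norm (f k) \<le> 1 / sqrt (real k)"
      using eventually_ge_at_top[of 1]
    proof eventually_elim
      case (elim k)
      then show ?case
        using nk[of k] by (auto simp: f_def intro!: divide_left_mono mult_pos_pos)
    qed
  qed
  \<comment> \<open>\<gamma> lies strictly between 1 and \<alpha>. The bound
    \<open>|D k| \<le> \<mu>\<close> ensures that \<open>n\<close> grows at least by the factor
    \<gamma>, and the cap \<open>1 / 2\<close> on \<mu> is the range of the estimate for
    \<open>ln (1 + D k)\<close>.\<close>
  define \<gamma> where "\<gamma> = (\<alpha> + 1) / 2"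
  define \<mu> where "\<mu> = min (1 / 2) ((\<alpha> - 1) / (2 * \<alpha>))"
  have "\<mu> > 0" using assms(1) by (simp add: \<mu>_def)
  have "(\<lambda>k. C * f k) \<longlonglongrightarrow> C * 0"
    by (intro tendsto_intros f0)
  then have "\<forall>\<^sub>F k in sequentially. C * f k < \<mu>"
    using \<open>\<mu> > 0\<close> by (intro order_tendstoD) auto
  then obtain N0 where N0: "\<And>k. k \<ge> N0 \<Longrightarrow> C * f k < \<mu>"
    unfolding eventually_sequentially by blast
  define N where "N = max 1 N0"
  have N: "N \<ge> 1" "\<And>k. k \<ge> N \<Longrightarrow> C * f k < \<mu>"
    using N0 by (simp_all add: N_def)
  have Dsmall: "\<bar>D k\<bar> \<le> \<mu>" if "k \<ge> N" for k
    using Df[of k] N that by fastforce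
  have ratio: "norm (f (Suc k)) \<le> (1 / sqrt \<gamma>) * norm (f k)" if "k \<ge> N" for k
  proof -
    have k: "k \<ge> 1" using N that by simp
    have "\<gamma> = \<alpha> * (1 - (\<alpha> - 1) / (2 * \<alpha>))"
      using assms(1) by (simp add: \<gamma>_def field_simps)
    also have "\<dots> \<le> \<alpha> * (1 + D k)"
      using assms(1) Dsmall[OF that] by (intro mult_left_mono) (auto simp: \<mu>_def)
    finally have "\<gamma> * real (n k) \<le> \<alpha> * (1 + D k) * real (n k)"
      by (intro mult_right_mono) auto
    then have "\<gamma> * real (n k) \<le> real (n (Suc k))"
      using step[OF k] by (simp add: mult_ac)
    then have "sqrt \<gamma> * sqrt (real (n k)) \<le> sqrt (real (n (Suc k)))"
      by (metis real_sqrt_le_mono real_sqrt_mult)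
    then have "1 / sqrt (real (n (Suc k))) \<le> 1 / (sqrt \<gamma> * sqrt (real (n k)))"
      using pos[OF k] pos[of "Suc k"] assms(1) by (intro divide_left_mono) (auto simp: \<gamma>_def)
    then show ?thesis by (simp add: f_def)
  qed
  have "summable f"
    by (rule summable_ratio_test[of "1 / sqrt \<gamma>" N]) (use ratio assms(1) in \<open>auto simp: \<gamma>_def\<close>)
  define u where "u k = ln (real (n k)) - real k * ln \<alpha>" for k
  have "summable (\<lambda>k. u (Suc k) - u k)"
  proof (rule summable_comparison_test_ev)
    show "\<forall>\<^sub>F k in sequentially. norm (u (Suc k) - u k) \<le> 2 * (C * f k)"
      using eventually_ge_at_top[of N]
    proof eventually_elim
      case (elim k)
      then have k: "k \<ge> 1" using N by simp
      have D: "\<bar>D k\<bar> \<le> 1 / 2" using Dsmall[OF elim] by (simp add: \<mu>_def)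
      have "ln (real (n (Suc k))) = ln (\<alpha> * real (n k)) + ln (1 + D k)"
        using step[OF k] D pos[OF k] assms(1) by (simp add: ln_mult_pos)
      then have "u (Suc k) - u k = ln (1 + D k)"
        using pos[OF k] assms(1) by (simp add: u_def ln_mult_pos algebra_simps)
      then show ?case
        using abs_ln_one_plus_le[OF D] Df[OF k] by simp
    qed
    show "summable (\<lambda>k. 2 * (C * f k))"
      by (intro summable_mult \<open>summable f\<close>)
  qed
  then have "convergent (\<lambda>m. \<Sum>k<m. u (Suc k) - u k)"
    by (simp add: summable_iff_convergent)
  \<comment> \<open>The term \<open>u 0\<close> depends on the unconstrained value
    \<open>n 0\<close>, but as a constant it does not affect convergence.\<close>
  then have "convergent (\<lambda>m. u m - u 0)"
    by (simp add: sum_lessThan_telescope)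
  then have "convergent u"
    using convergent_diff_const_right_iff by blast
  then show ?thesis by (simp add: u_def[abs_def])
qed

subsection \<open>Polynomials in the shift operator\<close>

text \<open>The operator \<open>q(\<tau>)\<close> on sequences, with \<tau> the shift by one,
  evaluated at \<open>k\<close>.\<close>

definition shift_comb :: "real poly \<Rightarrow> (nat \<Rightarrow> real) \<Rightarrow> nat \<Rightarrow> real" where
  "shift_comb q f k = (\<Sum>i\<le>degree q. coeff q i * f (k + i))"

lemma shift_comb_eq:
  assumes "degree q \<le> N"
  shows "shift_comb q f k = (\<Sum>i\<le>N. coeff q i * f (k + i))"
  unfolding shift_comb_def using assms
  by (intro sum.mono_neutral_left) (auto simp: coeff_eq_0)

lemma shift_comb_0 [simp]: "shift_comb 0 f k = 0"
  by (simp add: shift_comb_def)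

lemma shift_comb_pCons: "shift_comb (pCons c q) f k = c * f k + shift_comb q f (k + 1)"
proof -
  have "shift_comb (pCons c q) f k = (\<Sum>i\<le>Suc (degree q). coeff (pCons c q) i * f (k + i))"
    by (rule shift_comb_eq) (rule degree_pCons_le)
  also have "\<dots> = c * f k + shift_comb q f (k + 1)"
    unfolding sum.atMost_Suc_shift by (simp add: shift_comb_def)
  finally show ?thesis .
qed

lemma shift_comb_poly_add: "shift_comb (p + q) f k = shift_comb p f k + shift_comb q f k"
proof -
  let ?N = "max (degree p) (degree q)"
  have "shift_comb (p + q) f k = (\<Sum>i\<le>?N. coeff (p + q) i * f (k + i))"
    by (rule shift_comb_eq) (rule degree_add_le_max)
  also have "\<dots> = shift_comb p f k + shift_comb q f k"
    by (simp add: shift_comb_eq[of p ?N] shift_comb_eq[of q ?N] sum.distrib ring_distribs)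
  finally show ?thesis .
qed

lemma shift_comb_smult: "shift_comb (smult c q) f k = c * shift_comb q f k"
  by (simp add: shift_comb_eq[OF degree_smult_le] shift_comb_def sum_distrib_left mult_ac)

text \<open>Multiplication of polynomials becomes composition of operators, which lets a
  factorisation such as \<open>P = R * S\<close> act in two stages.\<close>

lemma shift_comb_mult: "shift_comb (p * q) f k = shift_comb p (shift_comb q f) k"
  by (induction p arbitrary: k)
    (simp_all add: shift_comb_pCons shift_comb_poly_add shift_comb_smult)

lemma shift_comb_add: "shift_comb q (\<lambda>k. f k + g k) k = shift_comb q f k + shift_comb q g k"
  by (simp add: shift_comb_def sum.distrib ring_distribs)

lemma shift_comb_scale: "shift_comb q (\<lambda>k. c * f k) k = c * shift_comb q f k"
  by (simp add: shift_comb_def sum_distrib_left mult_ac)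

lemma shift_comb_const: "shift_comb q (\<lambda>_. c) k = poly q 1 * c"
  by (simp add: shift_comb_def poly_altdef sum_distrib_right)

lemma shift_comb_linear:
  "shift_comb q real k = poly q 1 * real k + (\<Sum>i\<le>degree q. coeff q i * real i)"
  by (simp add: shift_comb_def poly_altdef sum_distrib_right sum.distrib ring_distribs)

lemma shift_comb_cong:
  assumes "\<And>j. j \<ge> k \<Longrightarrow> f j = g j"
  shows "shift_comb q f k = shift_comb q g k"
  by (simp add: shift_comb_def assms)

lemma tendsto_shift_comb:
  assumes "f \<longlonglongrightarrow> l"
  shows "shift_comb q f \<longlonglongrightarrow> poly q 1 * l"
proof -
  have "(\<lambda>k. \<Sum>i\<le>degree q. coeff q i * f (k + i)) \<longlonglongrightarrow> (\<Sum>i\<le>degree q. coeff q i * l)"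
    by (intro tendsto_sum tendsto_mult tendsto_const LIMSEQ_ignore_initial_segment assms)
  then show ?thesis
    by (simp add: shift_comb_def[abs_def] poly_altdef sum_distrib_right)
qed

lemma abs_shift_comb_le:
  assumes "\<And>j. j \<ge> k \<Longrightarrow> \<bar>f j\<bar> \<le> B"
  shows "\<bar>shift_comb q f k\<bar> \<le> (\<Sum>i\<le>degree q. \<bar>coeff q i\<bar>) * B"
proof -
  have "\<bar>shift_comb q f k\<bar> \<le> (\<Sum>i\<le>degree q. \<bar>coeff q i * f (k + i)\<bar>)"
    unfolding shift_comb_def by (rule sum_abs)
  also have "\<dots> \<le> (\<Sum>i\<le>degree q. \<bar>coeff q i\<bar> * B)"
    by (intro sum_mono) (simp add: abs_mult assms mult_left_mono)
  finally show ?thesis by (simp add: sum_distrib_right)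
qed

text \<open>
  The integers \<open>m (k + j) - \<lfloor>\<phi> * k\<rfloor>\<close> are bounded uniformly in \<open>k \<ge> 1\<close> and \<open>j \<le> degree S\<close>.
\<close>

lemma shift_comb_finitely_many_offsets:
  fixes m :: "nat \<Rightarrow> int" and \<phi> c B :: real
  assumes "\<And>k. k \<ge> 1 \<Longrightarrow> \<bar>of_int (m k) - \<phi> * real k\<bar> \<le> B"
  shows "\<exists>F. finite F \<and> (\<forall>k\<ge>1. \<exists>f\<in>F.
     shift_comb S (\<lambda>j. of_int (m j) - \<phi> * real j + c) k = f - poly S 1 * frac (\<phi> * real k))"
proof -
  let ?d = "degree S"
  define W where "W = \<lceil>B + \<bar>\<phi>\<bar> * real ?d + 1\<rceil>"
  \<comment> \<open>The combination with \<open>m (k + j) - \<phi> * (k + j)\<close> replaced by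
    \<open>w j - \<phi> * j\<close>, where \<open>w\<close> will hold the offsets from the floor of
    \<open>\<phi> * k\<close>. Each bracket thereby grows by \<open>frac (\<phi> * k)\<close>,
    whence the term \<open>poly S 1 * frac (\<phi> * k)\<close>.\<close>
  define g where "g w = (\<Sum>j\<le>?d. coeff S j * (of_int (w j) - \<phi> * real j + c))" for w :: "nat \<Rightarrow> int"
  define F where "F = g ` (PiE {..?d} (\<lambda>_. {-W..W}))"
  show ?thesis
  proof (intro exI[of _ F] conjI allI impI)
    show "finite F" by (simp add: F_def finite_PiE)
    fix k :: nat assume k: "k \<ge> 1"
    define w where "w = restrict (\<lambda>j. m (k + j) - \<lfloor>\<phi> * real k\<rfloor>) {..?d}"
    have fr: "of_int \<lfloor>\<phi> * real k\<rfloor> = \<phi> * real k - frac (\<phi> * real k)" by (simp add: frac_def)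
    have "m (k + j) - \<lfloor>\<phi> * real k\<rfloor> \<in> {-W..W}" if "j \<le> ?d" for j
    proof -
      have "\<bar>\<phi> * real j\<bar> \<le> \<bar>\<phi>\<bar> * real ?d"
        using that by (simp add: abs_mult mult_left_mono)
      moreover have "of_int (m (k + j) - \<lfloor>\<phi> * real k\<rfloor>)
          = (of_int (m (k + j)) - \<phi> * real (k + j)) + \<phi> * real j + frac (\<phi> * real k)"
        by (simp add: fr algebra_simps)
      ultimately have "\<bar>real_of_int (m (k + j) - \<lfloor>\<phi> * real k\<rfloor>)\<bar> \<le> B + \<bar>\<phi>\<bar> * real ?d + 1"
        using assms[of "k + j"] k frac_ge_0[of "\<phi> * real k"] frac_lt_1[of "\<phi> * real k"]
        by linarith
      then have "\<bar>m (k + j) - \<lfloor>\<phi> * real k\<rfloor>\<bar> \<le> W"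
        unfolding W_def by linarith
      then show ?thesis by auto
    qed
    then have "w \<in> PiE {..?d} (\<lambda>_. {-W..W})"
      by (auto simp: w_def)
    then have "g w \<in> F" by (simp add: F_def)
    moreover have "shift_comb S (\<lambda>j. of_int (m j) - \<phi> * real j + c) k = g w - poly S 1 * frac (\<phi> * real k)"
      unfolding g_def shift_comb_def poly_altdef sum_distrib_right sum_subtractf[symmetric]
      by (intro sum.cong) (auto simp: w_def fr algebra_simps)
    ultimately show "\<exists>f\<in>F. shift_comb S (\<lambda>j. of_int (m j) - \<phi> * real j + c) k
        = f - poly S 1 * frac (\<phi> * real k)" by blast
  qed
qed

subsection \<open>Thin sets\<close>

lemma compact_closure_minkowski_comb:
  assumes "bounded I"
  shows "compact (closure (minkowski_comb a d I))"
proof -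
  obtain B where B: "\<And>x. x \<in> I \<Longrightarrow> \<bar>x\<bar> \<le> B"
    using assms by (auto simp: bounded_iff)
  have "\<bar>\<Sum>s\<le>d. a s * x s\<bar> \<le> (\<Sum>s\<le>d. \<bar>a s\<bar> * B)" if "\<forall>s\<le>d. x s \<in> I" for x
  proof -
    have "\<bar>\<Sum>s\<le>d. a s * x s\<bar> \<le> (\<Sum>s\<le>d. \<bar>a s * x s\<bar>)" by (rule sum_abs)
    also have "\<dots> \<le> (\<Sum>s\<le>d. \<bar>a s\<bar> * B)"
      using B that by (intro sum_mono) (auto simp: abs_mult intro!: mult_left_mono)
    finally show ?thesis .
  qed
  then have "bounded (minkowski_comb a d I)"
    by (auto simp: bounded_iff minkowski_comb_def)
  then show ?thesis
    by (simp add: compact_eq_bounded_closed bounded_closure)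
qed

text \<open>Solving \<open>f - c * x = y\<close> for \<open>x\<close> is a Lipschitz map of
  \<open>y\<close>, and Lipschitz maps of the line preserve null sets. This transports a null set of
  values of \<open>P(\<tau>) \<sigma>\<close> to a null set of fractional parts.\<close>

lemma affine_images_compact_null:
  fixes K :: "real set" and c :: real
  assumes "compact K" "K \<in> null_sets lebesgue" "finite F" "c \<noteq> 0"
  shows "compact (\<Union>f\<in>F. (\<lambda>y. (f - y) / c) ` K) \<and> (\<Union>f\<in>F. (\<lambda>y. (f - y) / c) ` K) \<in> null_sets lebesgue"
proof
  show "compact (\<Union>f\<in>F. (\<lambda>y. (f - y) / c) ` K)"
    using assms by (intro compact_UN compact_continuous_image continuous_intros) auto
  have K: "negligible K"
    using assms(2) by (simp add: negligible_iff_null_sets)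
  have "negligible ((\<lambda>y. (f - y) / c) ` K)" for f
  proof (rule negligible_locally_Lipschitz_image[OF _ K])
    fix x
    have "norm ((f - y) / c - (f - x) / c) \<le> 1 / \<bar>c\<bar> * norm (y - x)" for y
      by (simp add: diff_divide_distrib[symmetric] abs_divide abs_minus_commute)
    then show "\<exists>T B. open T \<and> x \<in> T \<and>
        (\<forall>y\<in>K \<inter> T. norm ((f - y) / c - (f - x) / c) \<le> B * norm (y - x))"
      by (intro exI[of _ UNIV] exI[of _ "1 / \<bar>c\<bar>"] conjI open_UNIV UNIV_I ballI)
  qed simp
  then show "(\<Union>f\<in>F. (\<lambda>y. (f - y) / c) ` K) \<in> null_sets lebesgue"
    using assms(3) unfolding negligible_iff_null_sets[symmetric] by (intro negligible_Union) blast+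
qed

theorem theorem3p4:
  fixes \<alpha> \<beta> \<delta> \<theta> :: real and P :: "real poly" and a :: "nat \<Rightarrow> real" and d :: nat
    and n :: "nat \<Rightarrow> nat" and \<sigma> :: "nat \<Rightarrow> real" and I :: "real set"
  assumes "\<alpha> > 1" and "algebraic \<alpha>"
    and "P = (\<Sum>s\<le>d. monom (a s) s)"
    and "poly P 1 \<noteq> 0"
    and "\<And>z. galois_conjugate z (complex_of_real \<alpha>) \<Longrightarrow> z \<noteq> complex_of_real \<alpha> \<Longrightarrow>
           poly (map_poly complex_of_real P) z = 0"
    and "\<And>k. k \<ge> 1 \<Longrightarrow> n k > 0"
    and "strict_mono_on {1..} n"
    and "\<And>k. k \<ge> 1 \<Longrightarrow>
           \<sigma> k = real (n (k + 1)) - \<alpha> * real (n k) - \<beta> * ln (real (n k))"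
    and "bounded (\<sigma> ` {1..})"
    and "thin a d I"
    and "\<delta> = (INF J\<in>{J. open J \<and> I \<subseteq> J}. upper_uniform_density (hit_set \<sigma> J))"
    and "\<delta> > 1 - 1 / (real d + 1)"
    and "\<theta> = \<beta> * ln \<alpha> / (\<alpha> - 1)"
  shows "\<theta> \<in> \<rat>"
proof -
  obtain R S where P: "P = R * S" and int: "\<And>i. coeff ([:-\<alpha>, 1:] * R) i \<in> \<int>"
    using conjugate_factor[OF assms(2,5)] by blast
  have R1: "poly R 1 \<noteq> 0" and S1: "poly S 1 \<noteq> 0"
    using assms(4) P by auto
  \<comment> \<open>Since \<open>\<phi> = - \<theta> * poly T 1\<close> and \<open>poly T 1\<close>
    is a nonzero integer, it is enough to prove \<phi> rational.\<close>
  define \<phi> where "\<phi> = \<beta> * ln \<alpha> * poly R 1"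
  define T where "T = [:-\<alpha>, 1:] * R"
  have int_T: "coeff T i \<in> \<int>" for i
    unfolding T_def by (rule int)
  have "poly T 1 \<in> \<int>"
    unfolding poly_altdef by (intro Ints_sum Ints_mult Ints_power int_T) simp
  then have T_rat: "poly T 1 \<in> \<rat>" using Ints_subset_Rats by blast
  have T1: "poly T 1 = (1 - \<alpha>) * poly R 1" by (simp add: T_def algebra_simps)
  have "\<theta> * (\<alpha> - 1) = \<beta> * ln \<alpha>"
    using assms(1,13) by simp
  then have "\<theta> * poly T 1 = - \<phi>"
    unfolding T1 \<phi>_def by algebra
  then have \<theta>: "\<theta> = - \<phi> / poly T 1"
    using nonzero_eq_divide_eq[of "poly T 1" \<theta> "- \<phi>"] T1 R1 assms(1) by simp

  obtain B\<sigma> where B\<sigma>: "\<And>k. k \<ge> 1 \<Longrightarrow> \<bar>\<sigma> k\<bar> \<le> B\<sigma>"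
    using assms(9) by (auto simp: bounded_iff)
  define l where "l k = ln (real (n k))" for k
  have "convergent (\<lambda>k. l k - real k * ln \<alpha>)"
    unfolding l_def by (rule ln_minus_linear_convergent[where \<sigma> = \<sigma> and \<beta> = \<beta> and B = B\<sigma>, OF assms(1,6,7,8) B\<sigma>])
  then obtain \<Lambda> where "(\<lambda>k. l k - real k * ln \<alpha>) \<longlonglongrightarrow> \<Lambda>"
    by (auto simp: convergent_def)
  then have e: "(\<lambda>k. l k - real k * ln \<alpha> - \<Lambda>) \<longlonglongrightarrow> 0"
    by (simp add: LIM_zero)
  define e where "e k = l k - real k * ln \<alpha> - \<Lambda>" for k
  \<comment> \<open>The floor is exact: \<open>T\<close> has integer coefficients and
    \<open>n\<close> takes integer values.\<close>
  define m where "m k = \<lfloor>shift_comb T (\<lambda>k. real (n k)) k\<rfloor>" for k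
  have m: "of_int (m k) = shift_comb T (\<lambda>k. real (n k)) k" for k
  proof -
    have "shift_comb T (\<lambda>k. real (n k)) k \<in> \<int>"
      unfolding shift_comb_def T_def by (intro Ints_sum Ints_mult int) simp
    then show ?thesis by (simp add: m_def)
  qed
  define c where "c = - \<beta> * (ln \<alpha> * (\<Sum>i\<le>degree R. coeff R i * real i) + \<Lambda> * poly R 1)"
  define E where "E k = - \<beta> * shift_comb R e k" for k
  \<comment> \<open>\<open>R(\<tau>)\<close> is applied to the definition of \<sigma>. The integers
    come from \<open>T = (x - \<alpha>) R\<close>, and
    \<open>l k = k * ln \<alpha> + \<Lambda> + e k\<close> splits the logarithmic term into
    \<open>- \<phi> * k\<close>, the constant \<open>c\<close> and the null sequence
    \<open>E\<close>.\<close>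
  have Y: "shift_comb R \<sigma> k = of_int (m k) - \<phi> * real k + c + E k" if "k \<ge> 1" for k
  proof -
    have "shift_comb R \<sigma> k = shift_comb R (\<lambda>k. shift_comb [:-\<alpha>, 1:] (\<lambda>k. real (n k)) k + (- \<beta>) * l k) k"
      using that assms(8) by (intro shift_comb_cong) (simp add: shift_comb_pCons l_def)
    also have "\<dots> = shift_comb T (\<lambda>k. real (n k)) k - \<beta> * shift_comb R l k"
      unfolding shift_comb_add shift_comb_scale T_def mult.commute[of "[:-\<alpha>, 1:]"] shift_comb_mult by simp
    also have "shift_comb R l k = shift_comb R (\<lambda>k. ln \<alpha> * real k + (\<Lambda> + e k)) k"
      by (simp add: e_def mult.commute)
    also have "\<dots> = ln \<alpha> * (poly R 1 * real k + (\<Sum>i\<le>degree R. coeff R i * real i))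
        + (poly R 1 * \<Lambda> + shift_comb R e k)"
      unfolding shift_comb_add shift_comb_scale shift_comb_const shift_comb_linear ..
    finally show ?thesis by (simp add: m \<phi>_def c_def E_def algebra_simps)
  qed
  have E0: "E \<longlonglongrightarrow> 0"
    using tendsto_mult_left[OF tendsto_shift_comb[OF e, of R], of "- \<beta>"]
    by (simp add: E_def[abs_def] e_def[abs_def])
  then have "Bseq E" by (intro convergent_imp_Bseq convergentI)
  then obtain BE where BE: "\<And>k. \<bar>E k\<bar> \<le> BE"
    by (auto simp: Bseq_def)
  have mb: "\<bar>of_int (m k) - \<phi> * real k\<bar> \<le> (\<Sum>i\<le>degree R. \<bar>coeff R i\<bar>) * B\<sigma> + \<bar>c\<bar> + BE" if "k \<ge> 1" for k
  proof -
    have "\<bar>shift_comb R \<sigma> k\<bar> \<le> (\<Sum>i\<le>degree R. \<bar>coeff R i\<bar>) * B\<sigma>"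
      using that by (intro abs_shift_comb_le B\<sigma>) simp
    then show ?thesis using Y[OF that] BE[of k] by linarith
  qed
  obtain F where F: "finite F" "\<And>k. k \<ge> 1 \<Longrightarrow> \<exists>f\<in>F.
     shift_comb S (\<lambda>j. of_int (m j) - \<phi> * real j + c) k = f - poly S 1 * frac (\<phi> * real k)"
    using shift_comb_finitely_many_offsets[OF mb, of S c] by blast
  define E' where "E' = shift_comb S E"
  have E'0: "E' \<longlonglongrightarrow> 0"
    using tendsto_shift_comb[OF E0, of S] by (simp add: E'_def)
  \<comment> \<open>The remaining factor \<open>S(\<tau>)\<close> is applied to \<open>Y\<close>;
    the integers now enter only through the finite set \<open>F\<close>.\<close>
  have key: "\<exists>f\<in>F. shift_comb P \<sigma> k = f - poly S 1 * frac (\<phi> * real k) + E' k" if k: "k \<ge> 1" for k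
  proof -
    have "shift_comb P \<sigma> k = shift_comb S (shift_comb R \<sigma>) k"
      by (simp add: P mult.commute[of R] shift_comb_mult)
    also have "\<dots> = shift_comb S (\<lambda>j. (of_int (m j) - \<phi> * real j + c) + E j) k"
      using k Y by (intro shift_comb_cong) auto
    also have "\<dots> = shift_comb S (\<lambda>j. of_int (m j) - \<phi> * real j + c) k + E' k"
      by (simp only: shift_comb_add E'_def)
    finally show ?thesis using F(2)[OF k] by auto
  qed
  have coeff_P: "coeff P s = (if s \<le> d then a s else 0)" for s
    by (simp add: assms(3) coeff_sum if_distrib sum.delta cong: if_cong)
  have "degree P \<le> d"
    by (rule degree_le) (simp add: coeff_P)
  then have P_comb: "shift_comb P \<sigma> k = (\<Sum>s\<le>d. a s * \<sigma> (k + s))" for k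
    by (simp add: shift_comb_eq coeff_P)

  have "\<phi> \<in> \<rat>"
  proof (rule ccontr)
    assume irr: "\<phi> \<notin> \<rat>"
    define K0 where "K0 = closure (minkowski_comb a d I)"
    have "compact K0" "K0 \<in> null_sets lebesgue"
      using assms(10) compact_closure_minkowski_comb by (auto simp: K0_def thin_def)
    \<comment> \<open>Where \<open>frac (\<phi> * k)\<close> would lie if
      \<open>shift_comb P \<sigma> k\<close> were in \<open>K0\<close> and \<open>E' k\<close> were
      zero.\<close>
    define K where "K = (\<Union>f\<in>F. (\<lambda>y. (f - y) / poly S 1) ` K0)"
    have K: "compact K" "K \<in> null_sets lebesgue"
      using affine_images_compact_null[OF \<open>compact K0\<close> \<open>K0 \<in> null_sets lebesgue\<close> F(1) S1]
      by (simp_all add: K_def)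
    \<comment> \<open>The strict gap below \<delta> provides actual windows, and \<eta> is the
      proportion of their length that the union bound over \<open>d + 1\<close> shifts
      leaves.\<close>
    obtain \<delta>' where \<delta>': "1 - 1 / (real d + 1) < \<delta>'" "\<delta>' < \<delta>"
      using assms(12) dense by blast
    define \<eta> where "\<eta> = 1 - (real d + 1) * (1 - \<delta>')"
    have "\<eta> > 0"
      using \<delta>'(1) by (simp add: \<eta>_def field_simps)
    obtain r N where r: "r > 0" and N: "\<And>N' h. N' \<ge> N \<Longrightarrow>
        real (card {k\<in>{h+1..h+N'}. \<exists>y\<in>K. \<bar>frac (\<phi> * real k) - y\<bar> < r}) \<le> \<eta> / 2 * real N'"
      using irrational_rotation_near_null_set[OF irr K, of "\<eta> / 2"] \<open>\<eta> > 0\<close> by auto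
    \<comment> \<open>The tolerance \<open>|poly S 1| * r\<close> is halved: one half for replacing
      each \<open>\<sigma> (k + s)\<close> by a point of \<open>I\<close>, the other for
      \<open>E' k\<close>. The \<open>+ 1\<close> makes \<open>C\<close> positive.\<close>
    define C where "C = (\<Sum>s\<le>d. \<bar>a s\<bar>) + 1"
    have "C > 0" unfolding C_def by (intro add_nonneg_pos sum_nonneg) auto
    define \<rho> where "\<rho> = \<bar>poly S 1\<bar> * r / (2 * C)"
    have "\<rho> > 0" using r S1 \<open>C > 0\<close> by (simp add: \<rho>_def)
    define J where "J = (\<Union>x\<in>I. ball x \<rho>)"
    have J: "open J" "I \<subseteq> J" using \<open>\<rho> > 0\<close> by (auto simp: J_def)
    define A where "A = hit_set \<sigma> J"
    have "\<delta> \<le> upper_uniform_density A"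
      unfolding assms(11) A_def
    proof (rule cINF_lower)
      show "bdd_below ((\<lambda>J. upper_uniform_density (hit_set \<sigma> J)) ` {J. open J \<and> I \<subseteq> J})"
        by (rule bdd_belowI2[of _ 0]) (rule upper_uniform_density_nonneg)
      show "J \<in> {J. open J \<and> I \<subseteq> J}" using J by simp
    qed
    then have \<delta>'A: "\<delta>' < upper_uniform_density A" using \<delta>'(2) by simp
    obtain k0 where k0: "\<And>k. k \<ge> k0 \<Longrightarrow> \<bar>E' k\<bar> < \<bar>poly S 1\<bar> * r / 2"
      using LIMSEQ_D[OF E'0, of "\<bar>poly S 1\<bar> * r / 2"] r S1 by auto
    have good: "\<exists>y\<in>K. \<bar>frac (\<phi> * real k) - y\<bar> < r"
      if k: "k \<ge> k0" "k \<ge> 1" and A: "\<forall>s\<le>d. k + s \<in> A" for k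
    proof -
      have "\<forall>s. \<exists>x. s \<le> d \<longrightarrow> x \<in> I \<and> \<bar>\<sigma> (k + s) - x\<bar> < \<rho>"
        using A by (fastforce simp: A_def hit_set_def J_def dist_real_def abs_minus_commute)
      then obtain x where x: "\<And>s. s \<le> d \<Longrightarrow> x s \<in> I" "\<And>s. s \<le> d \<Longrightarrow> \<bar>\<sigma> (k + s) - x s\<bar> < \<rho>"
        by metis
      define y where "y = (\<Sum>s\<le>d. a s * x s)"
      have "y \<in> minkowski_comb a d I"
        using x(1) by (auto simp: y_def minkowski_comb_def)
      then have "y \<in> K0" using closure_subset by (auto simp: K0_def)
      have "\<bar>shift_comb P \<sigma> k - y\<bar> = \<bar>\<Sum>s\<le>d. a s * (\<sigma> (k + s) - x s)\<bar>"
        by (simp add: P_comb y_def sum_subtractf right_diff_distrib)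
      also have "\<dots> \<le> (\<Sum>s\<le>d. \<bar>a s * (\<sigma> (k + s) - x s)\<bar>)" by (rule sum_abs)
      also have "\<dots> \<le> (\<Sum>s\<le>d. \<bar>a s\<bar> * \<rho>)"
        using x(2) by (intro sum_mono) (simp add: abs_mult mult_left_mono less_imp_le)
      also have "\<dots> = (\<Sum>s\<le>d. \<bar>a s\<bar>) * \<rho>" by (simp add: sum_distrib_right)
      also have "\<dots> \<le> C * \<rho>"
        unfolding C_def using \<open>\<rho> > 0\<close> by (intro mult_right_mono) auto
      also have "\<dots> = \<bar>poly S 1\<bar> * r / 2" using \<open>C > 0\<close> by (simp add: \<rho>_def)
      finally have near: "\<bar>shift_comb P \<sigma> k - y\<bar> \<le> \<bar>poly S 1\<bar> * r / 2" .
      obtain f where f: "f \<in> F" "shift_comb P \<sigma> k = f - poly S 1 * frac (\<phi> * real k) + E' k"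
        using key[OF k(2)] by blast
      have "\<bar>poly S 1\<bar> * \<bar>frac (\<phi> * real k) - (f - y) / poly S 1\<bar>
          = \<bar>poly S 1 * frac (\<phi> * real k) - (f - y)\<bar>"
        using S1 by (simp add: abs_mult[symmetric] right_diff_distrib)
      also have "\<dots> < \<bar>poly S 1\<bar> * r"
        using near f(2) k0[OF k(1)] by linarith
      finally have "\<bar>frac (\<phi> * real k) - (f - y) / poly S 1\<bar> < r"
        using S1 by simp
      moreover have "(f - y) / poly S 1 \<in> K"
        using f(1) \<open>y \<in> K0\<close> by (auto simp: K_def)
      ultimately show ?thesis by blast
    qed
    \<comment> \<open>Some window contains at least \<open>\<eta> * N'\<close> indices, up to a
      constant, whose shifts all hit \<open>A\<close>. Apart from those below \<open>k0\<close> they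
      have \<open>frac (\<phi> * k)\<close> near \<open>K\<close>, and at most
      \<open>\<eta> / 2 * N'\<close> indices do. The resulting bound does not depend on
      \<open>N'\<close>.\<close>
    have count: "\<eta> / 2 * real N' \<le> (real d + 1) * real d + real k0" if N': "N' \<ge> N" "N' \<ge> 1" for N'
    proof -
      obtain h where "\<delta>' * real N' < real (card (A \<inter> {h + 1..h + N'}))"
        using upper_uniform_density_window[OF \<delta>'A N'(2)] by blast
      then have "\<eta> * real N' - (real d + 1) * real d \<le> real (card {k\<in>{h+1..h+N'}. \<forall>s\<le>d. k + s \<in> A})"
        unfolding \<eta>_def by (intro simultaneous_window_count) simp
      also have "card {k\<in>{h+1..h+N'}. \<forall>s\<le>d. k + s \<in> A}
          \<le> card ({k\<in>{h+1..h+N'}. \<exists>y\<in>K. \<bar>frac (\<phi> * real k) - y\<bar> < r} \<union> {..<k0})"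
        using good by (intro card_mono) force+
      also have "\<dots> \<le> card {k\<in>{h+1..h+N'}. \<exists>y\<in>K. \<bar>frac (\<phi> * real k) - y\<bar> < r} + k0"
        using card_Un_le[of _ "{..<k0}"] by simp
      finally have "\<eta> * real N' - (real d + 1) * real d
          \<le> real (card {k\<in>{h+1..h+N'}. \<exists>y\<in>K. \<bar>frac (\<phi> * real k) - y\<bar> < r}) + real k0"
        by simp
      then show ?thesis using N[OF N'(1), of h] by linarith
    qed
    obtain M :: nat where M: "((real d + 1) * real d + real k0) / (\<eta> / 2) < real M"
      using reals_Archimedean2 by blast
    have "((real d + 1) * real d + real k0) / (\<eta> / 2) < real (M + N + 1)"
      using M by simp
    then have "(real d + 1) * real d + real k0 < \<eta> / 2 * real (M + N + 1)"
      using \<open>\<eta> > 0\<close> by (simp add: pos_divide_less_eq mult.commute)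
    with count[of "M + N + 1"] show False by simp
  qed
  then show ?thesis
    unfolding \<theta> using T_rat by (intro Rats_divide Rats_minus_iff[THEN iffD2])
qed

end
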